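(* Assume that there exists a bi-Lipschitz homeomorphism from $\Omega$ onto a convex set $\Sigma$. Then there exists a constant $C(\Omega)>0$, depending on the set $\Omega$, such that, for any $V\subset\Omega$ with finite cardinality, $$s^*(V)\le C(\Omega)\inf_{\mu\in\mathcal P_c(\Omega)}\ \inf_{\nu\in\mathcal P(V)}d_\infty(\mu,\nu).$$
   Context: $d\in\mathbb N=\{1,2,\dots\}$, $\Omega\subset\mathbb R^d$ is open and bounded with Lipschitz boundary, and $\Sigma\subset\mathbb R^d$. For $s\ge0$, $\mathbb G_s(V)$ is the simple graph with vertex set $V$ in which two distinct vertices $x,y$ are adjacent iff $|x-y|\le s$. The connectivity threshold $s^*(V)$ is the infimum over all $s\ge0$ such that $\mathbb G_s(V)$ is connected. $\mathcal P_c(\Omega)$ is the set of Borel probability measures on $\Omega$ that are equivalent to Lebesgue measure on $\Omega$ (each absolutely continuous with respect to the other). $\mathcal P(V)$ is the set of probability measures supported on $V$. The $\infty$-Wasserstein distance between probability measures $\mu,\nu$ on $\Omega$ is $$d_\infty(\mu,\nu):=\inf_{\gamma\in\Gamma(\mu,\nu)}\operatorname{esssup}_{(\Omega\times\Omega,\gamma)}\{(x,y)\mapsto|x-y|\},$$ where $\Gamma(\mu,\nu)$ is the set of couplings of $\mu$ and $\nu$ (probability measures on $\Omega\times\Omega$ with marginals $\mu$ and $\nu$) and $\operatorname{esssup}$ is the usual essential supremum with respect to $\gamma$. *)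

theory Defs
  imports "HOL-Probability.Probability" "Graph_Theory.Graph_Theory"
begin

text \<open>
  Near each boundary point, \<open>\<Omega>\<close> is the strict epigraph of a Lipschitz function \<open>g\<close> in a
  suitably rotated coordinate system: \<open>e\<close> is the vertical direction and \<open>g\<close> lives on the
  hyperplane orthogonal to \<open>e\<close>.
\<close>
definition lipschitz_boundary :: "'a::euclidean_space set \<Rightarrow> bool" where
  "lipschitz_boundary \<Omega> \<longleftrightarrow>
    (\<forall>p\<in>frontier \<Omega>. \<exists>r>0. \<exists>e. norm e = 1 \<and>
      (\<exists>g :: 'a \<Rightarrow> real. (\<exists>L. lipschitz_on L {z. z \<bullet> e = 0} g) \<and>
        \<Omega> \<inter> ball p r = {y \<in> ball p r. g (y - (y \<bullet> e) *\<^sub>R e) < y \<bullet> e}))"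

definition bilipschitz_homeomorphic ::
  "'a::metric_space set \<Rightarrow> 'b::metric_space set \<Rightarrow> bool" where
  "bilipschitz_homeomorphic S T \<longleftrightarrow>
    (\<exists>f g. homeomorphism S T f g \<and> (\<exists>L. lipschitz_on L S f) \<and> (\<exists>L. lipschitz_on L T g))"

text \<open>An undirected edge is represented by its two opposite arcs.\<close>
definition geom_graph :: "real \<Rightarrow> 'a::metric_space set \<Rightarrow> 'a pair_pre_digraph" where
  "geom_graph s V =
    \<lparr> pverts = V, parcs = {(x, y). x \<in> V \<and> y \<in> V \<and> x \<noteq> y \<and> dist x y \<le> s} \<rparr>"

lemma pair_graph_geom_graph: "finite V \<Longrightarrow> pair_graph (geom_graph s V)"
  by unfold_locales
    (auto simp: geom_graph_def symmetric_def arcs_ends_conv dist_commute sym_def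
      intro: finite_subset[of _ "V \<times> V"])

text \<open>
  The infimum is taken in \<^typ>\<open>ennreal\<close>, so it is \<open>\<infinity>\<close> if no threshold makes the graph
  connected. By the convention of \<open>Digraph_Component.connected\<close>, the graph without vertices is
  not connected.
\<close>
definition connectivity_threshold :: "'a::metric_space set \<Rightarrow> ennreal" where
  "connectivity_threshold V =
    (INF s\<in>{s. 0 \<le> s \<and> Digraph_Component.connected (with_proj (geom_graph s V))}. ennreal s)"

definition prob_measures_on :: "'a::topological_space set \<Rightarrow> 'a measure set" where
  "prob_measures_on \<Omega> = {\<mu>. prob_space \<mu> \<and> sets \<mu> = sets (restrict_space borel \<Omega>)}"

definition prob_equiv_lebesgue :: "'a::euclidean_space set \<Rightarrow> 'a measure set" where
  "prob_equiv_lebesgue \<Omega> =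
    {\<mu> \<in> prob_measures_on \<Omega>.
      absolutely_continuous (restrict_space lborel \<Omega>) \<mu> \<and>
      absolutely_continuous \<mu> (restrict_space lborel \<Omega>)}"

text \<open>Measures supported on \<open>V \<subseteq> \<Omega>\<close>, regarded as measures on \<open>\<Omega>\<close>.\<close>
definition prob_supported :: "'a::topological_space set \<Rightarrow> 'a set \<Rightarrow> 'a measure set" where
  "prob_supported \<Omega> V = {\<nu> \<in> prob_measures_on \<Omega>. AE x in \<nu>. x \<in> V}"

definition couplings :: "'a measure \<Rightarrow> 'b measure \<Rightarrow> ('a \<times> 'b) measure set" where
  "couplings \<mu> \<nu> =
    {\<gamma>. prob_space \<gamma> \<and> sets \<gamma> = sets (\<mu> \<Otimes>\<^sub>M \<nu>) \<and> distr \<gamma> \<mu> fst = \<mu> \<and> distr \<gamma> \<nu> snd = \<nu>}"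

definition wasserstein_inf ::
  "'a::real_normed_vector measure \<Rightarrow> 'a measure \<Rightarrow> ennreal" where
  "wasserstein_inf \<mu> \<nu> =
    (INF \<gamma>\<in>couplings \<mu> \<nu>. esssup \<gamma> (\<lambda>(x, y). ennreal (norm (x - y))))"

text \<open>
  \<^const>\<open>esssup\<close> is \<open>\<infinity>\<close> on non-measurable functions; this lemma shows that the convention
  is irrelevant in \<^const>\<open>wasserstein_inf\<close>.
\<close>
lemma norm_diff_measurable_coupling:
  fixes \<mu> \<nu> :: "'a::euclidean_space measure"
  assumes "\<mu> \<in> prob_measures_on \<Omega>" "\<nu> \<in> prob_measures_on \<Omega>" "\<gamma> \<in> couplings \<mu> \<nu>"
  shows "(\<lambda>(x, y). ennreal (norm (x - y))) \<in> borel_measurable \<gamma>"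
proof -
  have id: "(\<lambda>x. x) \<in> borel_measurable \<mu>" "(\<lambda>x. x) \<in> borel_measurable \<nu>"
    using assms(1,2) measurable_restrict_space1[of "\<lambda>x::'a. x" borel borel \<Omega>]
    by (auto simp: prob_measures_on_def cong: measurable_cong_sets)
  have s: "sets \<gamma> = sets (\<mu> \<Otimes>\<^sub>M \<nu>)"
    using assms(3) by (simp add: couplings_def)
  have "fst \<in> borel_measurable (\<mu> \<Otimes>\<^sub>M \<nu>)" "snd \<in> borel_measurable (\<mu> \<Otimes>\<^sub>M \<nu>)"
    using measurable_compose[OF measurable_fst id(1)] measurable_compose[OF measurable_snd id(2)]
    by blast+
  then have "(\<lambda>p. ennreal (norm (fst p - snd p))) \<in> borel_measurable (\<mu> \<Otimes>\<^sub>M \<nu>)"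
    by measurable
  then show ?thesis
    by (simp add: case_prod_unfold measurable_cong_sets[OF s refl])
qed

end

theory Submission
  imports Defs
begin

text \<open>
  If an \<open>\<infinity>\<close>-transport plan moves a measure \<open>\<mu>\<close> that charges every nonempty open
  subset of \<open>\<Omega>\<close> onto a measure carried by \<open>V\<close>, and mass travels at most the distance \<open>t\<close>,
  then no open piece of \<open>\<Omega>\<close> can lie at distance more than \<open>t\<close> from \<open>V\<close>; as \<open>V\<close> is
  finite, the closed balls of radius \<open>t\<close> around \<open>V\<close> cover all of \<open>\<Omega>\<close>
  (\<open>coupling_imp_cover\<close>). If the graph with threshold \<open>2 * t\<close> were disconnected, the balls
  around one component and those around the remaining vertices would split the connected set
  \<open>\<Omega>\<close> into two disjoint nonempty relatively closed parts, because two closed balls of radius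
  \<open>t\<close> with a common point have centres at distance at most \<open>2 * t\<close>
  (\<open>connected_geom_graph_of_cover\<close>). Hence \<open>C = 2\<close> works. The homeomorphism onto a convex
  set serves to make \<open>\<Omega>\<close> connected.
\<close>

lemma pverts_geom_graph: "pverts (geom_graph s V) = V"
  by (simp add: geom_graph_def)

lemma mk_symmetric_geom_graph: "mk_symmetric (with_proj (geom_graph s V)) = geom_graph s V"
  by (auto simp: mk_symmetric_def geom_graph_def dist_commute)

text \<open>
  The nerve of a finite cover of a connected set by closed sets is connected. Here the nerve of
  the balls is contained in the graph, by the triangle inequality.
\<close>
lemma connected_geom_graph_of_cover:
  fixes S :: "'a::metric_space set"
  assumes S: "topological_space_class.connected S" and V: "finite V" "V \<subseteq> S" "V \<noteq> {}" and t: "0 \<le> t"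
    and cover: "S \<subseteq> (\<Union>v\<in>V. cball v t)"
  shows "Digraph_Component.connected (with_proj (geom_graph (2 * t) V))"
proof -
  let ?G = "with_proj (geom_graph (2 * t) V)"
  have "u \<rightarrow>\<^sup>*\<^bsub>?G\<^esub> w" if u: "u \<in> V" and w: "w \<in> V" for u w
  proof (rule ccontr)
    assume nw: "\<not> u \<rightarrow>\<^sup>*\<^bsub>?G\<^esub> w"
    interpret G: wf_digraph ?G
      by unfold_locales (auto simp: geom_graph_def)
    define A where "A = {v \<in> V. u \<rightarrow>\<^sup>*\<^bsub>?G\<^esub> v}"
    define P where "P = (\<Union>v\<in>A. cball v t)"
    define Q where "Q = (\<Union>v\<in>V - A. cball v t)"
    have "u \<in> A"
      using u by (simp add: A_def pverts_geom_graph)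
    then have "u \<in> P \<inter> S"
      using u V(2) t by (auto simp: P_def intro!: bexI[of _ u])
    then have "P \<inter> S \<noteq> {}"
      by blast
    moreover have "w \<in> Q \<inter> S"
      using nw w V(2) t by (auto simp: Q_def A_def intro!: bexI[of _ w])
    then have "Q \<inter> S \<noteq> {}"
      by blast
    moreover have "closed P" "closed Q"
      using V(1) by (auto simp: P_def Q_def A_def intro!: closed_UN)
    moreover have "S \<subseteq> P \<union> Q"
      using cover by (auto simp: P_def Q_def)
    ultimately obtain x where x: "x \<in> P" "x \<in> Q"
      using S unfolding connected_closed by blast
    then obtain a b where a: "a \<in> A" "dist a x \<le> t" and b: "b \<in> V - A" "dist b x \<le> t"
      by (auto simp: P_def Q_def)
    have "dist a b \<le> 2 * t"
      using a(2) b(2) dist_triangle2[of a b x] by linarith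
    moreover have "a \<noteq> b" "a \<in> V" "b \<in> V" "u \<rightarrow>\<^sup>*\<^bsub>?G\<^esub> a"
      using a b by (auto simp: A_def)
    ultimately have "a \<rightarrow>\<^bsub>?G\<^esub> b"
      by (simp add: geom_graph_def)
    with \<open>u \<rightarrow>\<^sup>*\<^bsub>?G\<^esub> a\<close> have "u \<rightarrow>\<^sup>*\<^bsub>?G\<^esub> b"
      by (rule G.reachable_adj_trans)
    with b(1) show False
      by (simp add: A_def)
  qed
  then show ?thesis
    using V(3) unfolding Digraph_Component.connected_def mk_symmetric_geom_graph
    by (intro strongly_connectedI) (auto simp: pverts_geom_graph)
qed

text \<open>
  The part of \<open>\<Omega>\<close> farther than \<open>t\<close> from \<open>V\<close> is open and, since its mass would have to
  travel farther than \<open>t\<close>, it is null for \<open>\<mu>\<close>. Then it is Lebesgue null, hence empty.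
\<close>
lemma coupling_imp_cover:
  fixes \<Omega> :: "'a::euclidean_space set"
  assumes \<Omega>: "open \<Omega>" and V: "finite V"
    and \<mu>: "\<mu> \<in> prob_equiv_lebesgue \<Omega>" and \<nu>: "\<nu> \<in> prob_supported \<Omega> V"
    and \<gamma>: "\<gamma> \<in> couplings \<mu> \<nu>"
    and t: "AE (x, y) in \<gamma>. norm (x - y) \<le> t"
  shows "\<Omega> \<subseteq> (\<Union>v\<in>V. cball v t)"
proof -
  define U where "U = \<Omega> - (\<Union>v\<in>V. cball v t)"
  have U: "open U" "U \<subseteq> \<Omega>"
    using \<Omega> V by (auto simp: U_def intro!: open_Diff closed_UN)
  have sets_\<mu>: "sets \<mu> = sets (restrict_space borel \<Omega>)"
    using \<mu> by (simp add: prob_equiv_lebesgue_def prob_measures_on_def)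
  have U_sets: "U \<in> sets \<mu>"
    using U \<Omega> by (simp add: sets_\<mu> sets_restrict_space_iff)
  have sets_\<gamma>: "sets \<gamma> = sets (\<mu> \<Otimes>\<^sub>M \<nu>)"
    and fst_\<gamma>: "distr \<gamma> \<mu> fst = \<mu>" and snd_\<gamma>: "distr \<gamma> \<nu> snd = \<nu>"
    using \<gamma> by (simp_all add: couplings_def)
  have fst_meas: "fst \<in> measurable \<gamma> \<mu>" and snd_meas: "snd \<in> measurable \<gamma> \<nu>"
    by (simp_all add: measurable_cong_sets[OF sets_\<gamma> refl])
  have "AE y in \<nu>. y \<in> V"
    using \<nu> by (simp add: prob_supported_def)
  then have "AE y in distr \<gamma> \<nu> snd. y \<in> V"
    by (simp only: snd_\<gamma>)
  then have "AE p in \<gamma>. snd p \<in> V"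
    by (rule AE_distrD[OF snd_meas])
  with t have "AE p in \<gamma>. fst p \<notin> U"
    by eventually_elim (auto simp: U_def dist_norm norm_minus_commute)
  then have "AE x in distr \<gamma> \<mu> fst. x \<notin> U"
    using U_sets by (subst AE_distr_iff[OF fst_meas]) (auto intro!: sets.sets_Collect_neg)
  then have "AE x in \<mu>. x \<notin> U"
    by (simp only: fst_\<gamma>)
  then have "U \<in> null_sets \<mu>"
    using U_sets by (simp add: AE_iff_null_sets)
  then have "U \<in> null_sets (restrict_space lborel \<Omega>)"
    using \<mu> by (auto simp: prob_equiv_lebesgue_def absolutely_continuous_def)
  then have "U \<in> null_sets lborel"
    using \<Omega> by (simp add: null_sets_restrict_space)
  then have "negligible U"
    by (simp add: negligible_iff_null_sets null_sets_completionI)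
  then have "U = {}"
    using U(1) open_not_negligible by blast
  then show ?thesis
    by (auto simp: U_def)
qed

lemma prob_supported_empty: "prob_supported \<Omega> {} = {}"
  by (auto simp: prob_supported_def prob_measures_on_def prob_space.AE_False)

lemma connectivity_threshold_le_esssup:
  fixes \<Omega> :: "'a::euclidean_space set"
  assumes \<Omega>: "open \<Omega>" "topological_space_class.connected \<Omega>" and V: "finite V" "V \<subseteq> \<Omega>"
    and \<mu>: "\<mu> \<in> prob_equiv_lebesgue \<Omega>" and \<nu>: "\<nu> \<in> prob_supported \<Omega> V"
    and \<gamma>: "\<gamma> \<in> couplings \<mu> \<nu>"
  shows "connectivity_threshold V \<le> 2 * esssup \<gamma> (\<lambda>(x, y). ennreal (norm (x - y)))"
    (is "_ \<le> 2 * ?e")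
proof (cases "?e")
  case (real t)
  have "AE p in \<gamma>. (\<lambda>(x, y). ennreal (norm (x - y))) p \<le> ?e"
    by (rule esssup_AE)
  then have "AE (x, y) in \<gamma>. norm (x - y) \<le> t"
    unfolding real(2) by eventually_elim (use real(1) in auto)
  then have "\<Omega> \<subseteq> (\<Union>v\<in>V. cball v t)"
    by (rule coupling_imp_cover[OF \<Omega>(1) V(1) \<mu> \<nu> \<gamma>])
  moreover have "V \<noteq> {}"
    using \<nu> by (auto simp: prob_supported_empty)
  ultimately have "Digraph_Component.connected (with_proj (geom_graph (2 * t) V))"
    using \<Omega>(2) V real(1) by (intro connected_geom_graph_of_cover)
  then have "connectivity_threshold V \<le> ennreal (2 * t)"
    unfolding connectivity_threshold_def using real(1) by (intro INF_lower) auto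
  then show ?thesis
    using real by (simp add: ennreal_mult)
qed (simp add: ennreal_mult_top)

theorem corollary4p10:
  fixes \<Omega> :: "'a::euclidean_space set"
  assumes "open \<Omega>" and "bounded \<Omega>" and "lipschitz_boundary \<Omega>"
    and "\<exists>\<Sigma> :: 'a set. convex \<Sigma> \<and> bilipschitz_homeomorphic \<Omega> \<Sigma>"
  shows "\<exists>C>0. \<forall>V. V \<subseteq> \<Omega> \<and> finite V \<longrightarrow>
    connectivity_threshold V \<le>
      ennreal C * (INF \<mu>\<in>prob_equiv_lebesgue \<Omega>. INF \<nu>\<in>prob_supported \<Omega> V. wasserstein_inf \<mu> \<nu>)"
proof -
  have conn: "topological_space_class.connected \<Omega>"
    using assms(4) unfolding bilipschitz_homeomorphic_def
    by (meson convex_connected homeomorphic_connectedness homeomorphic_def)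
  have "connectivity_threshold V \<le>
      2 * (INF \<mu>\<in>prob_equiv_lebesgue \<Omega>. INF \<nu>\<in>prob_supported \<Omega> V. wasserstein_inf \<mu> \<nu>)"
    if V: "V \<subseteq> \<Omega>" "finite V" for V
  proof -
    have "connectivity_threshold V / 2 \<le>
        (INF \<mu>\<in>prob_equiv_lebesgue \<Omega>. INF \<nu>\<in>prob_supported \<Omega> V. wasserstein_inf \<mu> \<nu>)"
      unfolding wasserstein_inf_def
      using connectivity_threshold_le_esssup[OF assms(1) conn V(2,1)]
      by (intro INF_greatest divide_le_posI_ennreal) (auto simp: mult.commute)
    then have "2 * (connectivity_threshold V / 2) \<le> 2 *
        (INF \<mu>\<in>prob_equiv_lebesgue \<Omega>. INF \<nu>\<in>prob_supported \<Omega> V. wasserstein_inf \<mu> \<nu>)"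
      by (rule mult_left_mono) simp
    then show ?thesis
      by (simp add: ennreal_times_divide mult_divide_eq_ennreal mult.commute[of 2])
  qed
  then show ?thesis
    by (intro exI[of _ 2]) auto
qed

end
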